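(* Let $X$ and $Y$ be compact Hausdorff spaces and let $\mu$ be a (continuous) stochastic map from $X$ to $Y$. For every Borel set $E\subseteq Y$, the function $X\to\mathbb{R}$, $x\mapsto\mu_x(E)$, is Borel measurable. In fact, if $E$ is open (respectively closed), then this function is lower (respectively upper) semi-continuous.
   Context: $\mathrm{ProbMeas}(Y)$ is the set of regular Borel probability measures on $Y$ (outer regular by open sets and inner regular by compact sets on all Borel sets), with the vague topology: the coarsest topology making $\mu\mapsto\int_Y\varphi\,d\mu$ continuous for every continuous $\varphi:Y\to\mathbb{C}$. A (continuous) stochastic map from $X$ to $Y$ is a continuous function $\mu:X\to\mathrm{ProbMeas}(Y)$, with value at $x$ written $\mu_x$. A real function $g$ on a topological space is lower (resp. upper) semi-continuous iff $g^{-1}((a,\infty))$ (resp. $g^{-1}((-\infty,a))$) is open for all $a\in\mathbb{R}$. *)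

theory Defs
  imports "HOL-Analysis.Analysis" "HOL-Probability.Probability_Measure"
begin

definition borel_of :: "'a topology \<Rightarrow> 'a measure" where
  "borel_of X = sigma (topspace X) {U. openin X U}"

lemma space_borel_of [simp]: "space (borel_of X) = topspace X"
  by (simp add: borel_of_def space_measure_of_conv)

lemma sets_borel_of: "sets (borel_of X) = sigma_sets (topspace X) {U. openin X U}"
  unfolding borel_of_def by (rule sets_measure_of) (auto dest: openin_subset)

lemma borel_of_euclidean: "borel_of euclidean = borel"
  by (simp add: borel_of_def borel_def)

definition outer_regular :: "'a topology \<Rightarrow> 'a measure \<Rightarrow> bool" where
  "outer_regular Y \<nu> \<longleftrightarrow>
    (\<forall>E\<in>sets \<nu>. emeasure \<nu> E = (INF U\<in>{U. openin Y U \<and> E \<subseteq> U}. emeasure \<nu> U))"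

definition inner_regular :: "'a topology \<Rightarrow> 'a measure \<Rightarrow> bool" where
  "inner_regular Y \<nu> \<longleftrightarrow>
    (\<forall>E\<in>sets \<nu>. emeasure \<nu> E = (SUP K\<in>{K. compactin Y K \<and> K \<subseteq> E}. emeasure \<nu> K))"

definition ProbMeas :: "'a topology \<Rightarrow> 'a measure set" where
  "ProbMeas Y = {\<nu>. sets \<nu> = sets (borel_of Y) \<and> prob_space \<nu> \<and>
                     outer_regular Y \<nu> \<and> inner_regular Y \<nu>}"

text \<open>
  The sets below form a subbase of the coarsest topology on \<open>ProbMeas Y\<close> that makes all the
  integration maps continuous; see \<open>continuous_map_vague_integral\<close> and \<open>vague_topology_coarsest\<close>.
\<close>

definition vague_topology :: "'a topology \<Rightarrow> 'a measure topology" where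
  "vague_topology Y = topology_generated_by
    {{\<nu> \<in> ProbMeas Y. (\<integral>y. \<phi> y \<partial>\<nu>) \<in> V} | (\<phi> :: 'a \<Rightarrow> complex) V.
      continuous_map Y euclidean \<phi> \<and> open V}"

lemma topspace_vague_topology [simp]: "topspace (vague_topology Y) = ProbMeas Y"
proof -
  have "ProbMeas Y \<in> {{\<nu> \<in> ProbMeas Y. (\<integral>y. \<phi> y \<partial>\<nu>) \<in> V} | (\<phi> :: 'a \<Rightarrow> complex) V.
      continuous_map Y euclidean \<phi> \<and> open V}"
    by (rule CollectI, rule exI[of _ "\<lambda>_. 0"], rule exI[of _ UNIV]) auto
  then show ?thesis
    unfolding vague_topology_def topology_generated_by_topspace by blast
qed

lemma continuous_map_vague_integral:
  fixes \<phi> :: "'a \<Rightarrow> complex"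
  assumes "continuous_map Y euclidean \<phi>"
  shows "continuous_map (vague_topology Y) euclidean (\<lambda>\<nu>. \<integral>y. \<phi> y \<partial>\<nu>)"
  unfolding continuous_map_def topspace_vague_topology
  using assms by (auto simp: vague_topology_def intro!: topology_generated_by_Basis)

lemma vague_topology_coarsest:
  assumes T: "topspace T = ProbMeas Y"
    and cont: "\<And>\<phi> :: 'a \<Rightarrow> complex. continuous_map Y euclidean \<phi> \<Longrightarrow>
                 continuous_map T euclidean (\<lambda>\<nu>. \<integral>y. \<phi> y \<partial>\<nu>)"
    and "openin (vague_topology Y) S"
  shows "openin T S"
proof -
  have "generate_topology_on {{\<nu> \<in> ProbMeas Y. (\<integral>y. \<phi> y \<partial>\<nu>) \<in> V} | (\<phi> :: 'a \<Rightarrow> complex) V.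
      continuous_map Y euclidean \<phi> \<and> open V} S"
    using assms(3) by (simp add: vague_topology_def openin_topology_generated_by_iff)
  then show ?thesis
  proof induction
    case (Basis s)
    then obtain \<phi> :: "'a \<Rightarrow> complex" and V where
      s: "s = {\<nu> \<in> topspace T. (\<integral>y. \<phi> y \<partial>\<nu>) \<in> V}" "continuous_map Y euclidean \<phi>" "open V"
      using T by auto
    then show ?case
      using openin_continuous_map_preimage[OF cont[OF s(2)], of V] by simp
  qed auto
qed

definition stochastic_map :: "'a topology \<Rightarrow> 'b topology \<Rightarrow> ('a \<Rightarrow> 'b measure) \<Rightarrow> bool" where
  "stochastic_map X Y \<mu> \<longleftrightarrow> continuous_map X (vague_topology Y) \<mu>"

definition lower_semicontinuous_map :: "'a topology \<Rightarrow> ('a \<Rightarrow> real) \<Rightarrow> bool" where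
  "lower_semicontinuous_map X g \<longleftrightarrow> (\<forall>a. openin X {x \<in> topspace X. g x \<in> {a<..}})"

definition upper_semicontinuous_map :: "'a topology \<Rightarrow> ('a \<Rightarrow> real) \<Rightarrow> bool" where
  "upper_semicontinuous_map X g \<longleftrightarrow> (\<forall>a. openin X {x \<in> topspace X. g x \<in> {..<a}})"

end

theory Submission
  imports Defs
begin

text \<open>
  For open \<open>E\<close> and \<open>a < \<mu>\<^sub>x(E)\<close>, inner regularity gives a compact \<open>K \<subseteq> E\<close> with \<open>a < \<mu>\<^sub>x(K)\<close>, and a
  Urysohn function \<open>\<phi>\<close> between the indicators of \<open>K\<close> and \<open>E\<close> turns \<open>a < \<integral> \<phi> d\<mu>\<^sub>x \<le> \<mu>\<^sub>x(E)\<close> into an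
  open condition on \<open>x\<close>. Closed sets follow by complementation, and general Borel sets by
  Dynkin's \<open>\<pi>\<close>-\<open>\<lambda>\<close> theorem applied to the intersection-stable generator of open sets.
\<close>

lemma ProbMeasD:
  assumes "\<nu> \<in> ProbMeas Y"
  shows "sets \<nu> = sets (borel_of Y)" "space \<nu> = topspace Y" "prob_space \<nu>" "inner_regular Y \<nu>"
  using assms sets_eq_imp_space_eq[of \<nu> "borel_of Y"] by (auto simp: ProbMeas_def)

lemma openin_sets_borel_of: "openin Y U \<Longrightarrow> U \<in> sets (borel_of Y)"
  by (simp add: sets_borel_of sigma_sets.Basic)

lemma closedin_sets_borel_of:
  assumes "closedin Y C"
  shows "C \<in> sets (borel_of Y)"
proof -
  have "topspace Y - (topspace Y - C) \<in> sets (borel_of Y)"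
    using assms openin_sets_borel_of[of Y "topspace Y - C"] sets.compl_sets[of _ "borel_of Y"]
    by auto
  then show ?thesis
    using closedin_subset[OF assms] by (simp add: double_diff)
qed

lemma continuous_map_borel_of_measurable:
  fixes f :: "'a \<Rightarrow> 'b::topological_space"
  assumes "continuous_map Y euclidean f"
  shows "f \<in> borel_measurable (borel_of Y)"
proof (rule borel_measurableI)
  fix S :: "'b set"
  assume "open S"
  then have "openin Y {y \<in> topspace Y. f y \<in> S}"
    using assms by (auto intro: openin_continuous_map_preimage)
  moreover have "f -` S \<inter> space (borel_of Y) = {y \<in> topspace Y. f y \<in> S}"
    by auto
  ultimately show "f -` S \<inter> space (borel_of Y) \<in> sets (borel_of Y)"
    by (simp add: openin_sets_borel_of)
qed

text \<open>The rays \<open>{a<..}\<close> generate the Borel sets of the reals, so it is enough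
  that their preimages are open.\<close>

lemma lower_semicontinuous_map_measurable:
  assumes "lower_semicontinuous_map X g"
  shows "g \<in> borel_measurable (borel_of X)"
  using assms
  by (auto simp: borel_measurable_iff_greater lower_semicontinuous_map_def
      intro: openin_sets_borel_of)

text \<open>A bounded measurable function is integrable against a finite measure; this supplies the
  integrability that \<open>integral_mono\<close> asks for below.\<close>

lemma ProbMeas_integrable_unit_interval:
  fixes f :: "'a \<Rightarrow> real"
  assumes \<nu>: "\<nu> \<in> ProbMeas Y" and f: "continuous_map Y euclidean f"
    "\<And>y. y \<in> topspace Y \<Longrightarrow> f y \<in> {0..1}"
  shows "integrable \<nu> f"
proof -
  interpret prob_space \<nu> using ProbMeasD[OF \<nu>] by blast
  have "f \<in> borel_measurable \<nu>"
    using continuous_map_borel_of_measurable[OF f(1)]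
      measurable_cong_sets[OF ProbMeasD(1)[OF \<nu>] refl] by blast
  then show ?thesis
    using f(2) by (intro integrable_const_bound[where B=1]) (auto simp: ProbMeasD[OF \<nu>])
qed

lemma ProbMeas_separating_function:
  assumes Y: "compact_space Y" "Hausdorff_space Y"
    and \<nu>: "\<nu> \<in> ProbMeas Y" and E: "openin Y E" and a: "0 \<le> a" "a < measure \<nu> E"
  obtains f :: "'a \<Rightarrow> real" where "continuous_map Y euclidean f"
    "\<And>y. y \<in> topspace Y \<Longrightarrow> f y \<in> {0..1}"
    "\<And>y. y \<in> topspace Y - E \<Longrightarrow> f y = 0"
    "a < (\<integral>y. f y \<partial>\<nu>)"
proof -
  interpret prob_space \<nu> using ProbMeasD[OF \<nu>] by blast
  note sets = ProbMeasD(1)[OF \<nu>] and space = ProbMeasD(2)[OF \<nu>]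
  \<comment> \<open>Here \<open>0 \<le> a\<close> matters: \<open>ennreal\<close> sends negative
    reals to 0, so for negative \<open>a\<close> the strict inequality would fail on a null set
    \<open>E\<close>.\<close>
  have "ennreal a < emeasure \<nu> E"
    using a by (simp add: emeasure_eq_measure ennreal_lessI)
  also have "\<dots> = (SUP K\<in>{K. compactin Y K \<and> K \<subseteq> E}. emeasure \<nu> K)"
    using ProbMeasD(4)[OF \<nu>] openin_sets_borel_of[OF E] sets by (auto simp: inner_regular_def)
  finally obtain K where K: "compactin Y K" "K \<subseteq> E" "ennreal a < emeasure \<nu> K"
    by (auto simp: less_SUP_iff)
  have aK: "a < measure \<nu> K"
    using K(3) a(1) by (simp add: emeasure_eq_measure ennreal_less_iff)
  have clK: "closedin Y K"
    using K(1) Y(2) by (rule compactin_imp_closedin[rotated])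
  \<comment> \<open>Compact Hausdorff spaces are normal, so Urysohn's lemma separates the closed
    sets \<open>topspace Y - E\<close> (value 0) and \<open>K\<close> (value 1).\<close>
  have "normal_space Y"
    using Y by (simp add: compact_Hausdorff_or_regular_imp_normal_space)
  moreover have "closedin Y (topspace Y - E)" using E by blast
  moreover have "disjnt (topspace Y - E) K" using K(2) by (auto simp: disjnt_def)
  ultimately obtain f where f: "continuous_map Y (top_of_set {0..1::real}) f"
    "f ` (topspace Y - E) \<subseteq> {0}" "f ` K \<subseteq> {1}"
    using Urysohn_lemma[of Y "topspace Y - E" K 0 1] clK by auto
  have cont: "continuous_map Y euclidean f"
    using f(1) continuous_map_in_subtopology by blast
  have range: "f y \<in> {0..1}" if "y \<in> topspace Y" for y
    using f(1) that by (auto simp: continuous_map_in_subtopology)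
  have Ksets: "K \<in> sets \<nu>" using closedin_sets_borel_of[OF clK] sets by simp
  have int: "integrable \<nu> f"
    using ProbMeas_integrable_unit_interval[OF \<nu> cont range] .
  have intK: "integrable \<nu> (indicator K :: 'a \<Rightarrow> real)"
    using Ksets by (simp add: emeasure_eq_measure)
  have "measure \<nu> K = (\<integral>y. indicator K y \<partial>\<nu>)"
    using Ksets by simp
  \<comment> \<open>\<open>indicator K\<close> lies below \<open>f\<close>, which is 1 on
    \<open>K\<close> and nonnegative elsewhere.\<close>
  also have "\<dots> \<le> (\<integral>y. f y \<partial>\<nu>)"
    using range f(3) by (intro integral_mono[OF intK int]) (auto simp: space indicator_def)
  finally have "a < (\<integral>y. f y \<partial>\<nu>)" using aK by simp
  then show thesis
    using cont range f(2) by (intro that) auto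
qed

lemma lower_semicontinuous_map_measure_open:
  fixes X :: "'a topology" and Y :: "'b topology" and \<mu> :: "'a \<Rightarrow> 'b measure"
  assumes Y: "compact_space Y" "Hausdorff_space Y"
    and \<mu>: "stochastic_map X Y \<mu>" and E: "openin Y E"
  shows "lower_semicontinuous_map X (\<lambda>x. measure (\<mu> x) E)"
  unfolding lower_semicontinuous_map_def
proof
  fix a :: real
  let ?S = "{x \<in> topspace X. measure (\<mu> x) E \<in> {a<..}}"
  have cont: "continuous_map X (vague_topology Y) \<mu>"
    using \<mu> by (simp add: stochastic_map_def)
  have PM: "\<mu> x \<in> ProbMeas Y" if "x \<in> topspace X" for x
    using cont that by (auto simp: continuous_map_def)
  show "openin X ?S"
  proof (cases "a < 0")
    \<comment> \<open>\<open>ProbMeas_separating_function\<close> needs a nonnegative level; below 0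
      the superlevel set is everything, since measures are nonnegative.\<close>
    case True
    then have "?S = topspace X"
      by (auto intro: less_le_trans[OF _ measure_nonneg])
    then show ?thesis by simp
  next
    case False
    show ?thesis
    \<comment> \<open>Openness is checked point by point, because the separating function depends on
      \<open>x\<close>.\<close>
    proof (subst openin_subopen, intro ballI)
      fix x assume "x \<in> ?S"
      then have x: "x \<in> topspace X" "a < measure (\<mu> x) E" by auto
      obtain f :: "'b \<Rightarrow> real" where f: "continuous_map Y euclidean f"
        "\<And>y. y \<in> topspace Y \<Longrightarrow> f y \<in> {0..1}"
        "\<And>y. y \<in> topspace Y - E \<Longrightarrow> f y = 0"
        "a < (\<integral>y. f y \<partial>\<mu> x)"
        using ProbMeas_separating_function[OF Y PM[OF x(1)] E _ x(2)] False by auto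
      \<comment> \<open>The vague topology tests against complex-valued functions: \<open>f\<close>
        is embedded into the complex numbers, and \<open>Re\<close> then recovers its real
        integral.\<close>
      have "continuous_map Y euclidean (complex_of_real \<circ> f)"
        by (rule continuous_map_compose[OF f(1)]) (simp add: continuous_intros)
      then have "continuous_map X euclidean
          ((\<lambda>\<nu>. \<integral>y. (complex_of_real \<circ> f) y \<partial>\<nu>) \<circ> \<mu>)"
        by (intro continuous_map_compose[OF cont continuous_map_vague_integral])
      then have "continuous_map X euclidean (Re \<circ> ((\<lambda>\<nu>. \<integral>y. (complex_of_real \<circ> f) y \<partial>\<nu>) \<circ> \<mu>))"
        by (rule continuous_map_compose) (simp add: continuous_intros)
      then have "continuous_map X euclidean (\<lambda>z. \<integral>y. f y \<partial>\<mu> z)"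
        by (simp add: o_def)
      then have op: "openin X {z \<in> topspace X. (\<integral>y. f y \<partial>\<mu> z) \<in> {a<..}}"
        by (rule openin_continuous_map_preimage) simp
      \<comment> \<open>Although \<open>f\<close> was chosen for the single measure
        \<open>\<mu> x\<close>, the pointwise bound of \<open>f\<close> by
        \<open>indicator E\<close> involves no measure, so it can be integrated against every
        \<open>\<mu> z\<close>.\<close>
      have le: "(\<integral>y. f y \<partial>\<mu> z) \<le> measure (\<mu> z) E" if z: "z \<in> topspace X" for z
      proof -
        note P = ProbMeasD[OF PM[OF z]]
        interpret prob_space "\<mu> z" by (rule P)
        have Es: "E \<in> sets (\<mu> z)" using openin_sets_borel_of[OF E] P by simp
        have int: "integrable (\<mu> z) f"
          using ProbMeas_integrable_unit_interval[OF PM[OF z] f(1,2)] .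
        have intE: "integrable (\<mu> z) (indicator E :: 'b \<Rightarrow> real)"
          using Es by (simp add: emeasure_eq_measure)
        have "(\<integral>y. f y \<partial>\<mu> z) \<le> (\<integral>y. indicator E y \<partial>\<mu> z)"
          using f(2,3) by (intro integral_mono[OF int intE]) (auto simp: P indicator_def)
        also have "\<dots> = measure (\<mu> z) E" using Es by simp
        finally show ?thesis .
      qed
      show "\<exists>T. openin X T \<and> x \<in> T \<and> T \<subseteq> ?S"
        using op x(1) f(4) le
        by (intro exI[of _ "{z \<in> topspace X. (\<integral>y. f y \<partial>\<mu> z) \<in> {a<..}}"])
          (auto intro: less_le_trans)
    qed
  qed
qed

lemma upper_semicontinuous_map_measure_closed:
  fixes X :: "'a topology" and Y :: "'b topology" and \<mu> :: "'a \<Rightarrow> 'b measure"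
  assumes Y: "compact_space Y" "Hausdorff_space Y"
    and \<mu>: "stochastic_map X Y \<mu>" and E: "closedin Y E"
  shows "upper_semicontinuous_map X (\<lambda>x. measure (\<mu> x) E)"
  unfolding upper_semicontinuous_map_def
proof
  fix a :: real
  have compl: "measure (\<mu> x) (topspace Y - E) = 1 - measure (\<mu> x) E" if "x \<in> topspace X" for x
  proof -
    have "\<mu> x \<in> ProbMeas Y"
      using \<mu> that by (auto simp: stochastic_map_def continuous_map_def)
    note P = ProbMeasD[OF this]
    interpret prob_space "\<mu> x" by (rule P)
    show ?thesis using prob_compl[of E] closedin_sets_borel_of[OF E] P by simp
  qed
  \<comment> \<open>The level \<open>1 - a\<close> is chosen so that \<open>1 - m > 1 - a\<close> is
    equivalent to \<open>m < a\<close>.\<close>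
  have "openin X {x \<in> topspace X. measure (\<mu> x) (topspace Y - E) \<in> {1 - a<..}}"
    using lower_semicontinuous_map_measure_open[OF Y \<mu>, of "topspace Y - E"] E
    by (auto simp: lower_semicontinuous_map_def)
  also have "{x \<in> topspace X. measure (\<mu> x) (topspace Y - E) \<in> {1 - a<..}} =
      {x \<in> topspace X. measure (\<mu> x) E \<in> {..<a}}"
    using compl by auto
  finally show "openin X {x \<in> topspace X. measure (\<mu> x) E \<in> {..<a}}" .
qed

lemma measurable_measure_stochastic_map:
  fixes X :: "'a topology" and Y :: "'b topology" and \<mu> :: "'a \<Rightarrow> 'b measure"
  assumes Y: "compact_space Y" "Hausdorff_space Y"
    and \<mu>: "stochastic_map X Y \<mu>" and E: "E \<in> sets (borel_of Y)"
  shows "(\<lambda>x. measure (\<mu> x) E) \<in> borel_measurable (borel_of X)"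
proof -
  have "\<mu> x \<in> ProbMeas Y" if "x \<in> topspace X" for x
    using \<mu> that by (auto simp: stochastic_map_def continuous_map_def)
  note P = ProbMeasD[OF this]
  have Int: "Int_stable {U. openin Y U}"
    by (auto simp: Int_stable_def)
  have sub: "{U. openin Y U} \<subseteq> Pow (topspace Y)"
    by (auto dest: openin_subset)
  have E': "E \<in> sigma_sets (topspace Y) {U. openin Y U}"
    using E by (simp add: sets_borel_of)
  \<comment> \<open>The sets with measurable evaluation form a \<lambda>-system containing the open
    sets. The disjoint form of the induction is used because the union case rests on countable
    additivity.\<close>
  from Int sub E' show ?thesis
  proof (induction rule: sigma_sets_induct_disjoint)
    case (basic U)
    then show ?case
      by (auto intro: lower_semicontinuous_map_measurable lower_semicontinuous_map_measure_open Y \<mu>)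
  next
    case empty
    show ?case by simp
  next
    case (compl A)
    have "measure (\<mu> x) (topspace Y - A) = 1 - measure (\<mu> x) A" if "x \<in> space (borel_of X)" for x
      using prob_space.prob_compl[OF P(3), of x A] that compl P by (simp add: sets_borel_of)
    \<comment> \<open>The identity is known only on \<open>topspace X\<close>, where
      \<open>\<mu> x\<close> is a probability measure; \<open>measurable_cong\<close> asks for no
      more.\<close>
    then show ?case
      using compl.IH by (subst measurable_cong[where g = "\<lambda>x. 1 - measure (\<mu> x) A"]) auto
  next
    case (union A)
    have "measure (\<mu> x) (\<Union>i. A i) = (\<Sum>i. measure (\<mu> x) (A i))" if "x \<in> space (borel_of X)" for x
    proof -
      interpret prob_space "\<mu> x" using P that by simp
      have "range A \<subseteq> sets (\<mu> x)"
        using union(2) that by (simp add: P sets_borel_of)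
      then show ?thesis
        using sums_unique[OF finite_measure_UNION] union(1) by blast
    qed
    \<comment> \<open>A pointwise series of measurable real functions is measurable.\<close>
    then show ?case
      using union.IH
      by (subst measurable_cong[where g = "\<lambda>x. \<Sum>i. measure (\<mu> x) (A i)"]) auto
  qed
qed

theorem lemma4p76:
  fixes X :: "'a topology" and Y :: "'b topology" and \<mu> :: "'a \<Rightarrow> 'b measure"
  assumes "compact_space X" and "Hausdorff_space X"
    and "compact_space Y" and "Hausdorff_space Y"
    and "stochastic_map X Y \<mu>"
  shows "(\<forall>E \<in> sets (borel_of Y). (\<lambda>x. measure (\<mu> x) E) \<in> borel_measurable (borel_of X)) \<and>
         (\<forall>E. openin Y E \<longrightarrow> lower_semicontinuous_map X (\<lambda>x. measure (\<mu> x) E)) \<and>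
         (\<forall>E. closedin Y E \<longrightarrow> upper_semicontinuous_map X (\<lambda>x. measure (\<mu> x) E))"
  using assms(3-5) by (blast intro: measurable_measure_stochastic_map
      lower_semicontinuous_map_measure_open upper_semicontinuous_map_measure_closed)

end
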